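(* Suppose $\gamma:\mathbb{R}\to\mathbb{R}^2$ is a smooth open translator for the curve diffusion flow, with constant vector $V$, satisfying $$\lim_{i\to\infty}\Big[\big(\kappa(p_i)\kappa_s(p_i)+\langle V,\gamma_s(p_i)\rangle\big)-\big(\kappa(q_i)\kappa_s(q_i)+\langle V,\gamma_s(q_i)\rangle\big)\Big]=0$$ for arbitrary sequences $\{p_i\}$ and $\{q_i\}$ asymptotic to $-\infty$ and $+\infty$ respectively. Then $\gamma(\mathbb{R})$ is a straight line.
   Context: All curves are smooth and regular. $s$ denotes arc length along $\gamma$, $\nu$ a choice of unit normal, and $\kappa=\langle\gamma_{ss},\nu\rangle$ the curvature. The curve diffusion flow is $\langle\partial_t\gamma,\nu\rangle=-\kappa_{ss}$. An open curve is a regular immersion $\gamma:\mathbb{R}\to\mathbb{R}^2$ for which there does not exist a pair of intervals $I,J$ with $I\cap J=\emptyset$, $|I|=\infty$, $|J|<\infty$ and $\gamma(I)=\gamma(J)$. A translator is a curve satisfying $-\kappa_{ss}\equiv\langle V,\nu\rangle$ for some constant vector $V\in\mathbb{R}^2$ (a solution evolving purely by translation); it is allowed that $V=0$.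
   Formalization: The curve is additionally assumed to have infinite length at both ends (automatic if parametrised by arc length on all of R); otherwise the claim fails, e.g. for (arctan t, 0) with V = 0, whose image is only a segment. *)

theory Defs
  imports "HOL-Analysis.Analysis"
begin

definition vderiv :: "(real \<Rightarrow> 'a::real_normed_vector) \<Rightarrow> real \<Rightarrow> 'a" where
  "vderiv f t = vector_derivative f (at t)"

(* vector_derivative is total (arbitrary where f is not differentiable), so differentiability of
   every iterate is what makes f infinitely differentiable *)
definition smooth :: "(real \<Rightarrow> 'a::real_normed_vector) \<Rightarrow> bool" where
  "smooth f \<longleftrightarrow> (\<forall>n t. (vderiv ^^ n) f differentiable (at t))"

definition regular_immersion :: "(real \<Rightarrow> real^2) \<Rightarrow> bool" where
  "regular_immersion \<gamma> \<longleftrightarrow> smooth \<gamma> \<and> (\<forall>t. vderiv \<gamma> t \<noteq> 0)"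

definition arc_length :: "(real \<Rightarrow> real^2) \<Rightarrow> real set \<Rightarrow> ennreal" where
  "arc_length \<gamma> I = (\<integral>\<^sup>+t\<in>I. ennreal (norm (vderiv \<gamma> t)) \<partial>lborel)"

(* Both ends have infinite length, i.e. the arc length parameter ranges over all of the reals.
   This holds for every curve on the real line that is parametrised by arc length. *)
definition complete_curve :: "(real \<Rightarrow> real^2) \<Rightarrow> bool" where
  "complete_curve \<gamma> \<longleftrightarrow> arc_length \<gamma> {..0} = \<infinity> \<and> arc_length \<gamma> {0..} = \<infinity>"

(* Interval lengths are measured along the curve. For a complete curve an interval has finite
   length in this sense iff it is bounded, so measuring in the parameter gives the same notion. *)
definition open_curve :: "(real \<Rightarrow> real^2) \<Rightarrow> bool" where
  "open_curve \<gamma> \<longleftrightarrow> regular_immersion \<gamma> \<and>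
     \<not> (\<exists>I J. is_interval I \<and> is_interval J \<and> I \<inter> J = {} \<and>
            arc_length \<gamma> I = \<infinity> \<and> arc_length \<gamma> J < \<infinity> \<and> \<gamma> ` I = \<gamma> ` J)"

(* d/ds = (1/|\<gamma>'|) d/dt for functions of an arbitrary parameter t of \<gamma> *)
definition arc_deriv ::
  "(real \<Rightarrow> real^2) \<Rightarrow> (real \<Rightarrow> 'a::real_normed_vector) \<Rightarrow> real \<Rightarrow> 'a" where
  "arc_deriv \<gamma> f t = vderiv f t /\<^sub>R norm (vderiv \<gamma> t)"

(* Continuity makes the choice of side consistent along the curve; smoothness of \<nu> then follows
   from that of \<gamma>. *)
definition unit_normal :: "(real \<Rightarrow> real^2) \<Rightarrow> (real \<Rightarrow> real^2) \<Rightarrow> bool" where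
  "unit_normal \<gamma> \<nu> \<longleftrightarrow> continuous_on UNIV \<nu> \<and>
     (\<forall>t. norm (\<nu> t) = 1 \<and> \<nu> t \<bullet> vderiv \<gamma> t = 0)"

definition curvature :: "(real \<Rightarrow> real^2) \<Rightarrow> (real \<Rightarrow> real^2) \<Rightarrow> real \<Rightarrow> real" where
  "curvature \<gamma> \<nu> t = arc_deriv \<gamma> (arc_deriv \<gamma> \<gamma>) t \<bullet> \<nu> t"

definition translator :: "(real \<Rightarrow> real^2) \<Rightarrow> (real \<Rightarrow> real^2) \<Rightarrow> real^2 \<Rightarrow> bool" where
  "translator \<gamma> \<nu> V \<longleftrightarrow>
     (\<forall>t. - arc_deriv \<gamma> (arc_deriv \<gamma> (curvature \<gamma> \<nu>)) t = V \<bullet> \<nu> t)"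

definition straight_line :: "(real^2) set \<Rightarrow> bool" where
  "straight_line L \<longleftrightarrow> (\<exists>a d. d \<noteq> 0 \<and> L = {a + c *\<^sub>R d | c. True})"

end

theory Submission
  imports Defs
begin

text \<open>
  Along a translator the Frenet equations give
  \<open>(\<kappa> \<kappa>\<^sub>s + \<langle>V, \<gamma>\<^sub>s\<rangle>)\<^sub>s = \<kappa>\<^sub>s\<^sup>2 + \<kappa> (\<kappa>\<^sub>s\<^sub>s + \<langle>V, \<nu>\<rangle>) = \<kappa>\<^sub>s\<^sup>2 \<ge> 0\<close>.
  This quantity is therefore nondecreasing, and as its oscillation between the two ends vanishes,
  it is constant. So \<open>\<kappa>\<^sub>s = 0\<close> and \<open>\<gamma>\<close> parametrises a line or a circle. On a circle the ray
  \<open>s \<le> 0\<close> and the single turn \<open>0 < s \<le> 2 \<pi> / \<bar>\<kappa>\<bar>\<close> have the same image, contradicting openness.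
\<close>

subsection \<open>Smooth functions\<close>

lemma has_vderiv: "f differentiable (at t) \<Longrightarrow> (f has_vector_derivative vderiv f t) (at t)"
  by (simp add: vderiv_def vector_derivative_works)

lemma vderiv_eqI: "(\<And>t. (f has_vector_derivative g t) (at t)) \<Longrightarrow> vderiv f = g"
  by (auto simp: vderiv_def fun_eq_iff intro: vector_derivative_at)

text \<open>A finite-order version of \<open>smooth\<close> that supports induction: it peels off
  the innermost derivative, so the induction hypothesis applies to \<open>vderiv f\<close>. The
  index is shifted by one: at 0 the function is already differentiable once.\<close>

fun differentiable_times :: "nat \<Rightarrow> (real \<Rightarrow> 'a::real_normed_vector) \<Rightarrow> bool" where
  "differentiable_times 0 f \<longleftrightarrow> (\<forall>t. f differentiable (at t))"
| "differentiable_times (Suc n) f \<longleftrightarrow>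
     (\<forall>t. f differentiable (at t)) \<and> differentiable_times n (vderiv f)"

lemma differentiable_times_iff:
  "differentiable_times n f \<longleftrightarrow> (\<forall>m\<le>n. \<forall>t. (vderiv ^^ m) f differentiable (at t))"
proof (induction n arbitrary: f)
  case (Suc n)
  show ?case
    unfolding differentiable_times.simps Suc.IH
  proof (intro iffI conjI allI impI)
    fix m t
    assume *: "(\<forall>t. f differentiable at t) \<and> (\<forall>m\<le>n. \<forall>t. (vderiv ^^ m) (vderiv f) differentiable at t)"
      and "m \<le> Suc n"
    then show "(vderiv ^^ m) f differentiable at t"
      by (cases m) (auto simp: funpow_Suc_right simp del: funpow.simps(2))
  next
    fix t assume "\<forall>m\<le>Suc n. \<forall>t. (vderiv ^^ m) f differentiable at t"
    from this[rule_format, of 0 t] show "f differentiable at t" by simp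
  next
    fix m t assume "\<forall>m\<le>Suc n. \<forall>t. (vderiv ^^ m) f differentiable at t" "m \<le> n"
    from this(1)[rule_format, of "Suc m" t] this(2) 
    show "(vderiv ^^ m) (vderiv f) differentiable at t"
      by (simp add: funpow_Suc_right del: funpow.simps(2))
  qed
qed simp

lemma smooth_iff: "smooth f \<longleftrightarrow> (\<forall>n. differentiable_times n f)"
  by (auto simp: smooth_def differentiable_times_iff)

lemma differentiable_times_Suc: "differentiable_times (Suc n) f \<Longrightarrow> differentiable_times n f"
  by (auto simp: differentiable_times_iff)

lemma differentiable_timesD: "differentiable_times n f \<Longrightarrow> f differentiable (at t)"
  by (cases n) auto

lemma smooth_imp_differentiable: "smooth f \<Longrightarrow> f differentiable (at t)"
  using differentiable_timesD smooth_iff by blast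

lemma smooth_vderiv: "smooth f \<Longrightarrow> smooth (vderiv f)"
  unfolding smooth_iff by (metis differentiable_times.simps(2))

lemma differentiable_times_add:
  assumes "differentiable_times n f" "differentiable_times n g"
  shows "differentiable_times n (\<lambda>t. f t + g t)"
  using assms
proof (induction n arbitrary: f g)
  case (Suc n)
  have "vderiv (\<lambda>t. f t + g t) = (\<lambda>t. vderiv f t + vderiv g t)"
    using Suc.prems by (intro vderiv_eqI has_vector_derivative_add has_vderiv) auto
  with Suc show ?case by auto
qed auto

text \<open>By the product rule the derivative is a sum of two products whose factors are all
  differentiable \<open>n\<close> times, so the induction closes. Working in the locale covers
  multiplication, scaling and inner product at once.\<close>

lemma (in bounded_bilinear) differentiable_times:
  assumes "differentiable_times n f" "differentiable_times n g"
  shows "differentiable_times n (\<lambda>t. prod (f t) (g t))"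
  using assms
proof (induction n arbitrary: f g)
  case 0
  then show ?case
    by (auto intro: differentiableI_vector[OF has_vector_derivative[OF has_vderiv has_vderiv]])
next
  case (Suc n)
  have der: "((\<lambda>t. prod (f t) (g t)) has_vector_derivative
      prod (f t) (vderiv g t) + prod (vderiv f t) (g t)) (at t)" for t
    using Suc.prems by (intro has_vector_derivative has_vderiv) auto
  have "differentiable_times n (\<lambda>t. prod (f t) (vderiv g t) + prod (vderiv f t) (g t))"
    using Suc.prems Suc.prems[THEN differentiable_times_Suc]
    by (intro differentiable_times_add Suc.IH) auto
  with der vderiv_eqI[OF der] show ?case
    by (auto intro: differentiableI_vector)
qed

lemma (in bounded_bilinear) smooth:
  "smooth f \<Longrightarrow> smooth g \<Longrightarrow> smooth (\<lambda>t. prod (f t) (g t))"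
  by (simp add: smooth_iff differentiable_times)

lemma smooth_const: "smooth (\<lambda>t. c)"
proof -
  have "differentiable_times n (\<lambda>t. c)" for n and c :: 'a
  proof (induction n arbitrary: c)
    case (Suc n)
    moreover have "vderiv (\<lambda>t. c) = (\<lambda>t. 0)"
      by (rule vderiv_eqI) simp
    ultimately show ?case by simp
  qed simp
  then show ?thesis by (simp add: smooth_iff)
qed

lemma (in bounded_linear) smooth:
  assumes "smooth g"
  shows "smooth (\<lambda>t. f (g t))"
proof -
  have "differentiable_times n (\<lambda>t. f (g t))" if "differentiable_times n g" for n g
    using that
  proof (induction n arbitrary: g)
    case 0
    then show ?case
      by (auto intro: differentiableI_vector[OF has_vector_derivative[OF has_vderiv]])
  next
    case (Suc n)
    have der: "((\<lambda>t. f (g t)) has_vector_derivative f (vderiv g t)) (at t)" for t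
      using Suc.prems by (intro has_vector_derivative has_vderiv) auto
    with Suc vderiv_eqI[OF der] show ?case
      by (auto intro: differentiableI_vector)
  qed
  with assms show ?thesis by (simp add: smooth_iff)
qed

lemma has_vector_derivative_inverse_sqrt:
  fixes g :: "real \<Rightarrow> real"
  assumes "(g has_vector_derivative g') (at t)" "g t > 0"
  shows "((\<lambda>t. inverse (sqrt (g t))) has_vector_derivative
    - ((inverse (sqrt (g t)))^3 * g') / 2) (at t)"
  using assms
  by (auto simp: has_real_derivative_iff_has_vector_derivative[symmetric] field_simps power3_eq_cube
      intro!: derivative_eq_intros)

text \<open>The function \<open>w = inverse (sqrt g)\<close> satisfies w' = - w^3 g' / 2. Its
  derivative is thus a product of copies of \<open>w\<close> and a smooth function, so each order of
  differentiability of \<open>w\<close> yields the next.\<close>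

lemma smooth_inverse_sqrt:
  fixes g :: "real \<Rightarrow> real"
  assumes "smooth g" and pos: "\<And>t. g t > 0"
  shows "smooth (\<lambda>t. inverse (sqrt (g t)))" (is "smooth ?w")
proof -
  have der: "(?w has_vector_derivative (- 1/2) * (?w t * (?w t * (?w t * vderiv g t)))) (at t)" for t
    using has_vector_derivative_inverse_sqrt[OF has_vderiv[OF smooth_imp_differentiable[OF assms(1)]] pos,
        of t]
    by (simp add: power3_eq_cube mult.assoc)
  have "differentiable_times n ?w" for n
  proof (induction n)
    case 0
    then show ?case using der by (auto intro: differentiableI_vector)
  next
    case (Suc n)
    have "differentiable_times n (\<lambda>t. (- 1/2) * (?w t * (?w t * (?w t * vderiv g t))))"
      using smooth_vderiv[OF assms(1)] smooth_const[of "- 1/2 :: real"]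
      by (intro bounded_bilinear.differentiable_times[OF bounded_bilinear_mult] Suc)
        (auto simp: smooth_iff)
    with der vderiv_eqI[OF der] show ?case
      by (auto intro: differentiableI_vector)
  qed
  then show ?thesis by (simp add: smooth_iff)
qed

subsection \<open>The Frenet equations\<close>

lemma regular_immersionD:
  assumes "regular_immersion \<gamma>"
  shows "smooth \<gamma>" "norm (vderiv \<gamma> t) > 0"
  using assms by (auto simp: regular_immersion_def)

lemma smooth_arc_deriv:
  assumes "regular_immersion \<gamma>" "smooth f"
  shows "smooth (arc_deriv \<gamma> f)"
proof -
  note \<gamma> = regular_immersionD[OF assms(1)]
  \<comment> \<open>Writing the speed as the root of an inner product puts the factor 1/|\<gamma>'|
    into the form just treated; regularity keeps the radicand positive.\<close>
  have "smooth (\<lambda>t. inverse (sqrt (vderiv \<gamma> t \<bullet> vderiv \<gamma> t)) *\<^sub>R vderiv f t)"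
    using \<gamma> assms(2)
    by (intro bounded_bilinear.smooth[OF bounded_bilinear_scaleR] smooth_inverse_sqrt
        bounded_bilinear.smooth[OF bounded_bilinear_inner] smooth_vderiv) auto
  then show ?thesis
    by (simp add: arc_deriv_def[abs_def] norm_eq_sqrt_inner)
qed

lemma has_vector_derivative_arc_deriv:
  assumes "regular_immersion \<gamma>" "smooth f"
  shows "(f has_vector_derivative norm (vderiv \<gamma> t) *\<^sub>R arc_deriv \<gamma> f t) (at t)"
  using has_vderiv[OF smooth_imp_differentiable[OF assms(2)], of t]
    regular_immersionD(2)[OF assms(1), of t]
  by (simp add: arc_deriv_def)

lemma norm_arc_deriv_self:
  assumes "regular_immersion \<gamma>"
  shows "norm (arc_deriv \<gamma> \<gamma> t) = 1"
  using regular_immersionD(2)[OF assms, of t] by (simp add: arc_deriv_def)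

lemma unit_normal_arc_deriv:
  assumes "unit_normal \<gamma> \<nu>"
  shows "\<nu> t \<bullet> arc_deriv \<gamma> \<gamma> t = 0"
  using assms by (simp add: arc_deriv_def unit_normal_def)

lemma orthonormal_expansion:
  fixes x T N :: "real^2"
  assumes "norm T = 1" "norm N = 1" "N \<bullet> T = 0"
  shows "x = (x \<bullet> T) *\<^sub>R T + (x \<bullet> N) *\<^sub>R N"
proof -
  define a b c d where "a = T$1" "b = T$2" "c = N$1" "d = N$2"
  have h: "a*a+b*b = 1" "c*c+d*d = 1" "c*a+d*b = 0"
    using assms by (auto simp: norm_eq_1 inner_vec_def sum_2 a_b_c_d_def)
  \<comment> \<open>A square matrix with orthonormal rows has orthonormal columns.\<close>
  have "(a*d-b*c)^2 = 1"
    using h by algebra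
  then have "a*a+c*c = 1" "b*b+d*d = 1" "a*b+c*d = 0"
    using h by algebra+
  then have "x$1 = (x$1*a+x$2*b)*a + (x$1*c+x$2*d)*c" "x$2 = (x$1*a+x$2*b)*b + (x$1*c+x$2*d)*d"
    by algebra+
  then show ?thesis
    by (simp add: vec_eq_iff forall_2 inner_vec_def sum_2 a_b_c_d_def)
qed

text \<open>The counterclockwise quarter turn. Applied to the unit tangent it gives a unit normal
  that is as smooth as the tangent.\<close>

definition rot :: "real^2 \<Rightarrow> real^2" where
  "rot x = vector [- x$2, x$1]"

lemma bounded_linear_rot: "bounded_linear rot"
  by (auto intro!: linear_conv_bounded_linear[THEN iffD1] linearI
      simp: rot_def vec_eq_iff forall_2)

lemma rot_inner: "rot x \<bullet> x = 0" and norm_rot: "norm (rot x) = norm x"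
  by (auto simp: rot_def inner_vec_def sum_2 norm_eq_sqrt_inner)

text \<open>In the plane \<nu> can only be plus or minus the quarter turn of the tangent. The sign
  is continuous with values in {-1, 1}, hence constant on the connected real line.\<close>

lemma smooth_unit_normal:
  assumes "regular_immersion \<gamma>" "unit_normal \<gamma> \<nu>"
  shows "smooth \<nu>"
proof -
  define T where "T = arc_deriv \<gamma> \<gamma>"
  define e where "e t = \<nu> t \<bullet> rot (T t)" for t
  have sT: "smooth (\<lambda>t. rot (T t))"
    unfolding T_def using assms(1)
    by (intro bounded_linear.smooth[OF bounded_linear_rot] smooth_arc_deriv regular_immersionD)
  have T: "norm (T t) = 1" "\<nu> t \<bullet> T t = 0" and \<nu>: "norm (\<nu> t) = 1" for t
    using norm_arc_deriv_self[OF assms(1)] unit_normal_arc_deriv[OF assms(2)] assms(2)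
    by (auto simp: T_def unit_normal_def)
  have \<nu>_eq: "\<nu> t = e t *\<^sub>R rot (T t)" for t
    using orthonormal_expansion[of "T t" "rot (T t)" "\<nu> t"] T[of t]
    by (simp add: norm_rot rot_inner e_def)
  have e: "e t \<in> {-1, 1}" for t
    using \<nu>[of t] T[of t] by (subst (asm) \<nu>_eq) (auto simp: norm_rot abs_if split: if_splits)
  have "continuous_on UNIV (\<lambda>t. rot (T t))"
    using smooth_imp_differentiable[OF sT]
    by (simp add: continuous_on_eq_continuous_within differentiable_imp_continuous_within)
  then have "continuous_on UNIV e"
    using assms(2) unfolding e_def unit_normal_def by (auto intro!: continuous_intros)
  then have "e constant_on UNIV"
    using e by (intro continuous_finite_range_constant)
      (auto intro: finite_subset[of _ "{-1,1}"])
  then obtain c where "\<And>t. e t = c"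
    by (auto simp: constant_on_def)
  then have "\<nu> = (\<lambda>t. c *\<^sub>R rot (T t))"
    using \<nu>_eq by auto
  then show ?thesis
    using bounded_linear.smooth[OF bounded_linear_scaleR_right sT] by simp
qed

lemma smooth_curvature:
  assumes "regular_immersion \<gamma>" "unit_normal \<gamma> \<nu>"
  shows "smooth (curvature \<gamma> \<nu>)"
  unfolding curvature_def[abs_def] using assms
  by (intro bounded_bilinear.smooth[OF bounded_bilinear_inner] smooth_arc_deriv
      smooth_unit_normal regular_immersionD)

text \<open>Differentiating <T, T> = 1 shows that \<open>T_s\<close> is orthogonal to
  \<open>T\<close>, so only its normal component survives, and that is the curvature by definition.
  The speed appears because the derivative is taken in \<open>t\<close>.\<close>

lemma frenet_tangent:
  assumes "regular_immersion \<gamma>" "unit_normal \<gamma> \<nu>"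
  shows "(arc_deriv \<gamma> \<gamma> has_vector_derivative
    (norm (vderiv \<gamma> t) * curvature \<gamma> \<nu> t) *\<^sub>R \<nu> t) (at t)"
proof -
  define T where "T = arc_deriv \<gamma> \<gamma>"
  have sT: "smooth T"
    using assms(1) by (simp add: T_def smooth_arc_deriv regular_immersionD)
  note dT = has_vector_derivative_arc_deriv[OF assms(1) sT, of t]
  have "((\<lambda>t. T t \<bullet> T t) has_vector_derivative
      T t \<bullet> (norm (vderiv \<gamma> t) *\<^sub>R arc_deriv \<gamma> T t) + (norm (vderiv \<gamma> t) *\<^sub>R arc_deriv \<gamma> T t) \<bullet> T t) (at t)"
    by (intro bounded_bilinear.has_vector_derivative[OF bounded_bilinear_inner] dT)
  moreover have "(\<lambda>t. T t \<bullet> T t) = (\<lambda>t. 1)"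
    using norm_arc_deriv_self[OF assms(1)] by (auto simp: T_def norm_eq_1)
  ultimately have "T t \<bullet> (norm (vderiv \<gamma> t) *\<^sub>R arc_deriv \<gamma> T t)
      + (norm (vderiv \<gamma> t) *\<^sub>R arc_deriv \<gamma> T t) \<bullet> T t = 0"
    by (metis has_vector_derivative_const vector_derivative_unique_at)
  then have "arc_deriv \<gamma> T t \<bullet> T t = 0"
    using regular_immersionD(2)[OF assms(1), of t] by (simp add: inner_commute)
  then have "arc_deriv \<gamma> T t = curvature \<gamma> \<nu> t *\<^sub>R \<nu> t"
    using orthonormal_expansion[of "T t" "\<nu> t" "arc_deriv \<gamma> T t"]
      norm_arc_deriv_self[OF assms(1)] unit_normal_arc_deriv[OF assms(2)] assms(2)
    by (simp add: T_def curvature_def unit_normal_def)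
  with dT show ?thesis by (simp add: T_def)
qed

text \<open>Differentiating <\<nu>, \<nu>> = 1 removes the normal component of \<nu>', and
  differentiating <\<nu>, T> = 0 determines the tangential one from the equation for
  \<open>T\<close>.\<close>

lemma frenet_normal:
  assumes "regular_immersion \<gamma>" "unit_normal \<gamma> \<nu>"
  shows "(\<nu> has_vector_derivative
    - (norm (vderiv \<gamma> t) * curvature \<gamma> \<nu> t) *\<^sub>R arc_deriv \<gamma> \<gamma> t) (at t)"
proof -
  define T where "T = arc_deriv \<gamma> \<gamma>"
  define k where "k = norm (vderiv \<gamma> t) * curvature \<gamma> \<nu> t"
  have dT: "(T has_vector_derivative k *\<^sub>R \<nu> t) (at t)"
    unfolding T_def k_def by (rule frenet_tangent[OF assms])
  have d\<nu>: "(\<nu> has_vector_derivative vderiv \<nu> t) (at t)"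
    using has_vderiv smooth_imp_differentiable smooth_unit_normal[OF assms] by blast
  have n: "norm (T t) = 1" "\<nu> t \<bullet> T t = 0" "norm (\<nu> t) = 1" for t
    using norm_arc_deriv_self[OF assms(1)] unit_normal_arc_deriv[OF assms(2)] assms(2)
    by (auto simp: T_def unit_normal_def)
  have "((\<lambda>t. \<nu> t \<bullet> \<nu> t) has_vector_derivative \<nu> t \<bullet> vderiv \<nu> t + vderiv \<nu> t \<bullet> \<nu> t) (at t)"
    by (intro bounded_bilinear.has_vector_derivative[OF bounded_bilinear_inner] d\<nu>)
  moreover have "(\<lambda>t. \<nu> t \<bullet> \<nu> t) = (\<lambda>t. 1)"
    using n(3) by (auto simp: norm_eq_1)
  ultimately have "\<nu> t \<bullet> vderiv \<nu> t + vderiv \<nu> t \<bullet> \<nu> t = 0"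
    by (metis has_vector_derivative_const vector_derivative_unique_at)
  then have 1: "vderiv \<nu> t \<bullet> \<nu> t = 0"
    by (simp add: inner_commute)
  have "((\<lambda>t. \<nu> t \<bullet> T t) has_vector_derivative \<nu> t \<bullet> (k *\<^sub>R \<nu> t) + vderiv \<nu> t \<bullet> T t) (at t)"
    by (intro bounded_bilinear.has_vector_derivative[OF bounded_bilinear_inner] d\<nu> dT)
  moreover have "(\<lambda>t. \<nu> t \<bullet> T t) = (\<lambda>t. 0)"
    using n(2) by auto
  ultimately have "\<nu> t \<bullet> (k *\<^sub>R \<nu> t) + vderiv \<nu> t \<bullet> T t = 0"
    by (metis has_vector_derivative_const vector_derivative_unique_at)
  then have 2: "vderiv \<nu> t \<bullet> T t = - k"
    using n(3)[of t] by (simp add: norm_eq_1)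
  from orthonormal_expansion[of "T t" "\<nu> t" "vderiv \<nu> t"] n 1 2
  have "vderiv \<nu> t = - k *\<^sub>R T t" by simp
  with d\<nu> show ?thesis by (simp add: T_def k_def)
qed

section \<open>Constancy of the curvature along a translator\<close>

lemma constant_curvature:
  assumes reg: "regular_immersion \<gamma>" and \<nu>: "unit_normal \<gamma> \<nu>" and V: "translator \<gamma> \<nu> V"
    and lim: "\<And>p q :: nat \<Rightarrow> real.
      filterlim p at_bot sequentially \<Longrightarrow> filterlim q at_top sequentially \<Longrightarrow>
      (\<lambda>i. (curvature \<gamma> \<nu> (p i) * arc_deriv \<gamma> (curvature \<gamma> \<nu>) (p i) + V \<bullet> arc_deriv \<gamma> \<gamma> (p i))
         - (curvature \<gamma> \<nu> (q i) * arc_deriv \<gamma> (curvature \<gamma> \<nu>) (q i) + V \<bullet> arc_deriv \<gamma> \<gamma> (q i)))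
        \<longlonglongrightarrow> 0"
  obtains k where "\<And>t. curvature \<gamma> \<nu> t = k"
proof -
  define \<kappa> where "\<kappa> = curvature \<gamma> \<nu>"
  define \<kappa>s where "\<kappa>s = arc_deriv \<gamma> \<kappa>"
  define v where "v t = norm (vderiv \<gamma> t)" for t
  define F where "F t = \<kappa> t * \<kappa>s t + V \<bullet> arc_deriv \<gamma> \<gamma> t" for t
  have s\<kappa>: "smooth \<kappa>" and s\<kappa>s: "smooth \<kappa>s"
    by (simp_all add: \<kappa>_def \<kappa>s_def smooth_curvature smooth_arc_deriv reg \<nu>)
  have v: "v t > 0" for t
    using regular_immersionD(2)[OF reg] by (simp add: v_def)
  have dF: "(F has_real_derivative v t * (\<kappa>s t)\<^sup>2) (at t)" for t
  proof -
    have "(F has_vector_derivative (\<kappa> t * (v t * arc_deriv \<gamma> \<kappa>s t) + (v t * \<kappa>s t) * \<kappa>s t)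
        + V \<bullet> ((v t * \<kappa> t) *\<^sub>R \<nu> t)) (at t)"
      using has_vector_derivative_arc_deriv[OF reg s\<kappa>, of t]
        has_vector_derivative_arc_deriv[OF reg s\<kappa>s, of t] frenet_tangent[OF reg \<nu>, of t]
      unfolding F_def
      by (intro has_vector_derivative_add has_vector_derivative_mult
          bounded_linear.has_vector_derivative[OF bounded_linear_inner_right])
        (auto simp: v_def \<kappa>_def \<kappa>s_def)
    \<comment> \<open>Substituting the translator equation cancels the second-derivative term
      against the term in <V, \<nu>>; only the square of \<open>\<kappa>s\<close>, times the speed,
      remains.\<close>
    moreover have "arc_deriv \<gamma> \<kappa>s t = - (V \<bullet> \<nu> t)"
      using V unfolding translator_def \<kappa>s_def \<kappa>_def by (metis minus_minus)
    ultimately show ?thesis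
      by (simp add: has_real_derivative_iff_has_vector_derivative power2_eq_square algebra_simps)
  qed
  have mono: "F a \<le> F b" if "a \<le> b" for a b
    using that dF v by (intro DERIV_nonneg_imp_nondecreasing[of a b F])
      (meson less_imp_le mult_nonneg_nonneg zero_le_power2)+
  have const: "F a = F b" if "a \<le> b" for a b
  proof (rule antisym)
    \<comment> \<open>The limit hypothesis is applied to the one pair of sequences -i and i.\<close>
    have bot: "filterlim (\<lambda>i. - real i) at_bot sequentially"
      and top: "filterlim real at_top sequentially"
      by (auto simp: filterlim_real_sequentially filterlim_uminus_at_top[symmetric])
    have "(\<lambda>i. F (- real i) - F (real i)) \<longlonglongrightarrow> 0"
      using lim[OF bot top] by (simp add: F_def \<kappa>s_def \<kappa>_def)
    \<comment> \<open>For large i both \<open>a\<close> and \<open>b\<close> lie in [-i, i], so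
      monotonicity gives F(-i) \<le> F(a) and F(b) \<le> F(i). Passing to the limit yields 0 \<le>
      F(a) - F(b).\<close>
    moreover have "\<forall>\<^sub>F i in sequentially. F (- real i) - F (real i) \<le> F a - F b"
      using eventually_ge_at_top[of "nat \<lceil>\<bar>a\<bar> + \<bar>b\<bar>\<rceil>"]
    proof eventually_elim
      case (elim i)
      then have "\<bar>a\<bar> + \<bar>b\<bar> \<le> real i" by linarith
      then show ?case
        using mono[of "- real i" a] mono[of b "real i"] by linarith
    qed
    ultimately have "0 \<le> F a - F b"
      by (rule tendsto_upperbound) simp
    then show "F b \<le> F a" by simp
  qed (rule mono[OF that])
  then have "F = (\<lambda>t. F 0)"
    by (metis linear)
  then have "(F has_real_derivative 0) (at t)" for t
    by (metis DERIV_const)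
  then have "v t * (\<kappa>s t)\<^sup>2 = 0" for t
    using dF DERIV_unique by blast
  then have "\<kappa>s t = 0" for t
    using v by (metis less_irrefl mult_eq_0_iff power_eq_0_iff)
  then have "(\<kappa> has_real_derivative 0) (at t)" for t
    using has_vector_derivative_arc_deriv[OF reg s\<kappa>, of t]
    by (simp add: \<kappa>s_def has_real_derivative_iff_has_vector_derivative)
  then have "\<kappa> t = \<kappa> 0" for t
    using DERIV_isconst_all by blast
  then show ?thesis
    using that \<kappa>_def by blast
qed

subsection \<open>The arc length parameter\<close>

text \<open>Provides the limit at infinity required by the fundamental theorem of calculus on a
  half-line.\<close>

lemma mono_tendsto_SUP_at_top:
  fixes f :: "real \<Rightarrow> real"
  assumes "mono f" "bdd_above (range f)"
  shows "(f \<longlongrightarrow> (SUP x. f x)) at_top"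
proof (rule increasing_tendsto)
  show "\<forall>\<^sub>F x in at_top. f x \<le> (SUP x. f x)"
    by (simp add: assms(2) cSUP_upper)
next
  fix y assume "y < (SUP x. f x)"
  then obtain a where "y < f a"
    using assms(2) by (auto simp: less_cSUP_iff)
  then show "\<forall>\<^sub>F x in at_top. y < f x"
    using assms(1) by (auto intro!: eventually_at_top_linorderI[of a] dest: monoD less_le_trans)
qed

text \<open>A bounded nondecreasing \<open>F\<close> would converge at infinity, and the integral
  over the half-line would be the finite difference of that limit and \<open>F 0\<close>.\<close>

lemma unbounded_above_antiderivative:
  fixes f F :: "real \<Rightarrow> real"
  assumes F: "\<And>t. (F has_real_derivative f t) (at t)"
    and f: "f \<in> borel_measurable borel" "\<And>t. 0 \<le> f t"
    and inf: "(\<integral>\<^sup>+t. ennreal (f t) * indicator {0..} t \<partial>lborel) = \<infinity>"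
  shows "\<exists>t. y \<le> F t"
proof (rule ccontr)
  assume "\<not> (\<exists>t. y \<le> F t)"
  then have bdd: "bdd_above (range F)"
    by (auto simp: bdd_above_def not_le intro!: exI[of _ y] less_imp_le)
  have "mono F"
    using F f(2) by (blast intro: monoI DERIV_nonneg_imp_nondecreasing[of _ _ F])
  from nn_integral_FTC_atLeast[OF f(1) F f(2) mono_tendsto_SUP_at_top[OF this bdd], of 0] inf
  show False by simp
qed

lemma continuous_vderiv:
  assumes "smooth f"
  shows "continuous_on UNIV (vderiv f)"
  using smooth_imp_differentiable[OF smooth_vderiv[OF assms]]
  by (simp add: continuous_on_eq_continuous_within differentiable_imp_continuous_within)

text \<open>The continuous speed has an antiderivative, normalised to vanish at 0. Completeness
  makes it unbounded in both directions, and the intermediate value theorem then gives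
  surjectivity.\<close>

lemma arc_length_parameter:
  assumes reg: "regular_immersion \<gamma>" and compl: "complete_curve \<gamma>"
  obtains s :: "real \<Rightarrow> real"
  where "\<And>t. (s has_real_derivative norm (vderiv \<gamma> t)) (at t)" "s 0 = 0" "strict_mono s" "surj s"
proof -
  define v where "v t = norm (vderiv \<gamma> t)" for t
  have v: "v t > 0" for t
    using regular_immersionD(2)[OF reg] by (simp add: v_def)
  have cont: "continuous_on UNIV v"
    unfolding v_def using continuous_vderiv[OF regular_immersionD(1)[OF reg]]
    by (intro continuous_intros)
  then have meas [measurable]: "v \<in> borel_measurable borel"
    by (rule borel_measurable_continuous_onI)
  obtain G where G: "\<And>t. (G has_vector_derivative v t) (at t)"
    using einterval_antiderivative[of "-\<infinity>" \<infinity> v] cont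
    by (auto simp: continuous_on_eq_continuous_at)
  define s where "s t = G t - G 0" for t
  have ds: "(s has_real_derivative v t) (at t)" for t
    using has_vector_derivative_diff[OF G has_vector_derivative_const]
    by (simp add: s_def[abs_def] has_real_derivative_iff_has_vector_derivative)
  have sm: "strict_mono s"
    using ds v by (blast intro: strict_monoI DERIV_pos_imp_increasing[of _ _ s])
  have top: "\<exists>t. y \<le> s t" for y
    using compl less_imp_le[OF v]
    by (intro unbounded_above_antiderivative[OF ds])
      (auto simp: complete_curve_def arc_length_def v_def[symmetric])
  \<comment> \<open>The reflection t to -t turns the left end into a right end; the reflected speed
    has the antiderivative \<open>- s (- t)\<close>.\<close>
  have "(\<integral>\<^sup>+t. ennreal (v t) * indicator {..0} t \<partial>lborel)
      = (\<integral>\<^sup>+t. ennreal (v (- t)) * indicator {0..} t \<partial>lborel)"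
    by (subst nn_integral_real_affine[where c = "-1" and t = 0])
      (auto intro!: nn_integral_cong split: split_indicator)
  then have inf: "(\<integral>\<^sup>+t. ennreal (v (- t)) * indicator {0..} t \<partial>lborel) = \<infinity>"
    using compl by (simp add: complete_curve_def arc_length_def v_def[symmetric])
  have "((\<lambda>t. - s (- t)) has_real_derivative v (- t)) (at t)" for t
    using DERIV_minus[OF DERIV_chain2[OF ds DERIV_minus[OF DERIV_ident], of t]] by simp
  then have "\<exists>t. - y \<le> - s (- t)" for y
    by (rule unbounded_above_antiderivative[OF _ _ less_imp_le[OF v] inf]) measurable
  then have bot: "\<exists>t. s t \<le> y" for y
    by (metis neg_le_iff_le)
  have "y \<in> range s" for y
  proof -
    obtain a b where ab: "s a \<le> y" "y \<le> s b" using top bot by blast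
    then have "a \<le> b"
      using sm by (metis order.trans strict_mono_less_eq)
    with ab show ?thesis
      using IVT[of s a y b] ds DERIV_isCont by blast
  qed
  then show ?thesis
    using that[of s] ds sm by (auto simp: v_def s_def)
qed

lemma arc_length_Icc:
  assumes reg: "regular_immersion \<gamma>"
    and s: "\<And>t. (s has_real_derivative norm (vderiv \<gamma> t)) (at t)" and "a \<le> b"
  shows "arc_length \<gamma> {a..b} = ennreal (s b - s a)"
  unfolding arc_length_def
proof (rule nn_integral_FTC_Icc)
  show "(\<lambda>t. norm (vderiv \<gamma> t)) \<in> borel_measurable borel"
    using continuous_vderiv[OF regular_immersionD(1)[OF reg]]
    by (intro borel_measurable_continuous_onI continuous_intros)
qed (use assms(3) in \<open>auto intro: s\<close>)

subsection \<open>Curves of constant curvature\<close>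

text \<open>The tangent is a constant vector \<open>d\<close>, so \<gamma> - s d is constant as
  well. Surjectivity of \<open>s\<close> makes the image the full line rather than a segment or a
  ray.\<close>

lemma constant_curvature_zero_line:
  assumes reg: "regular_immersion \<gamma>" and \<nu>: "unit_normal \<gamma> \<nu>"
    and curv: "\<And>t. curvature \<gamma> \<nu> t = 0"
    and s: "\<And>t. (s has_real_derivative norm (vderiv \<gamma> t)) (at t)" "surj s"
  shows "straight_line (range \<gamma>)"
proof -
  define T where "T = arc_deriv \<gamma> \<gamma>"
  have "(T has_vector_derivative 0) (at t)" for t
    using frenet_tangent[OF reg \<nu>, of t] curv by (simp add: T_def)
  then obtain d where d: "\<And>t. T t = d"
    using has_vector_derivative_zero_constant[of UNIV T] by auto
  have "((\<lambda>t. \<gamma> t - s t *\<^sub>R d) has_vector_derivative 0) (at t)" for t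
    by (rule has_vector_derivative_eq_rhs[OF has_vector_derivative_diff[OF
          has_vector_derivative_arc_deriv[OF reg regular_immersionD(1)[OF reg]]
          has_vector_derivative_scaleR[OF s(1) has_vector_derivative_const]]])
      (simp add: d[unfolded T_def])
  then obtain a where "\<And>t. \<gamma> t - s t *\<^sub>R d = a"
    using has_vector_derivative_zero_constant[of UNIV "\<lambda>t. \<gamma> t - s t *\<^sub>R d"] by auto
  then have \<gamma>: "\<gamma> = (\<lambda>t. a + s t *\<^sub>R d)"
    by (metis diff_add_cancel add.commute)
  have "d \<noteq> 0"
    using norm_arc_deriv_self[OF reg] d by (metis T_def norm_zero zero_neq_one)
  moreover have "range \<gamma> = {a + c *\<^sub>R d |c. True}"
  proof -
    have "range \<gamma> = (\<lambda>c. a + c *\<^sub>R d) ` range s"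
      by (auto simp: \<gamma>)
    with s(2) show ?thesis by auto
  qed
  ultimately show ?thesis
    unfolding straight_line_def by blast
qed

text \<open>The formula exhibits \<gamma> as a periodic function of arc length, and it is this
  periodicity that conflicts with openness.\<close>

lemma constant_curvature_circle:
  assumes reg: "regular_immersion \<gamma>" and \<nu>: "unit_normal \<gamma> \<nu>"
    and curv: "\<And>t. curvature \<gamma> \<nu> t = k" and k: "k \<noteq> 0"
    and s: "\<And>t. (s has_real_derivative norm (vderiv \<gamma> t)) (at t)"
  obtains c A B where "\<And>t. \<gamma> t = c + sin (k * s t) *\<^sub>R A + cos (k * s t) *\<^sub>R B"
proof -
  define T where "T = arc_deriv \<gamma> \<gamma>"
  define v where "v t = norm (vderiv \<gamma> t)" for t
  have dT: "(T has_vector_derivative (v t * k) *\<^sub>R \<nu> t) (at t)" for t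
    using frenet_tangent[OF reg \<nu>, of t] curv by (simp add: T_def v_def)
  have d\<nu>: "(\<nu> has_vector_derivative - (v t * k) *\<^sub>R T t) (at t)" for t
    using frenet_normal[OF reg \<nu>, of t] curv by (simp add: T_def v_def)
  have d\<gamma>: "(\<gamma> has_vector_derivative v t *\<^sub>R T t) (at t)" for t
    using has_vector_derivative_arc_deriv[OF reg regular_immersionD(1)[OF reg]]
    by (simp add: T_def v_def)
  have dcos: "((\<lambda>t. cos (k * s t)) has_real_derivative - sin (k * s t) * (k * v t)) (at t)"
    and dsin: "((\<lambda>t. sin (k * s t)) has_real_derivative cos (k * s t) * (k * v t)) (at t)" for t
    using s by (auto intro!: derivative_eq_intros simp: v_def)
  \<comment> \<open>Rotating the Frenet frame back by the tangent angle \<open>k s\<close> gives a constant frame \<open>A, B\<close>.\<close>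
  have "((\<lambda>t. cos (k * s t) *\<^sub>R T t - sin (k * s t) *\<^sub>R \<nu> t) has_vector_derivative 0) (at t)" for t
    by (rule has_vector_derivative_eq_rhs[OF has_vector_derivative_diff[OF
          has_vector_derivative_scaleR[OF dcos dT] has_vector_derivative_scaleR[OF dsin d\<nu>]]])
      (simp add: algebra_simps)
  then obtain A where A: "\<And>t. cos (k * s t) *\<^sub>R T t - sin (k * s t) *\<^sub>R \<nu> t = A"
    using has_vector_derivative_zero_constant[of UNIV "\<lambda>t. cos (k * s t) *\<^sub>R T t - sin (k * s t) *\<^sub>R \<nu> t"]
    by auto
  have "((\<lambda>t. sin (k * s t) *\<^sub>R T t + cos (k * s t) *\<^sub>R \<nu> t) has_vector_derivative 0) (at t)" for t
    by (rule has_vector_derivative_eq_rhs[OF has_vector_derivative_add[OF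
          has_vector_derivative_scaleR[OF dsin dT] has_vector_derivative_scaleR[OF dcos d\<nu>]]])
      (simp add: algebra_simps)
  then obtain B where B: "\<And>t. sin (k * s t) *\<^sub>R T t + cos (k * s t) *\<^sub>R \<nu> t = B"
    using has_vector_derivative_zero_constant[of UNIV "\<lambda>t. sin (k * s t) *\<^sub>R T t + cos (k * s t) *\<^sub>R \<nu> t"]
    by auto
  \<comment> \<open>Inverts the rotation: \<nu> is recovered from the constant frame.\<close>
  have \<nu>_eq: "\<nu> t = cos (k * s t) *\<^sub>R B - sin (k * s t) *\<^sub>R A" for t
  proof -
    have "cos (k * s t) *\<^sub>R B - sin (k * s t) *\<^sub>R A
        = (cos (k * s t) * cos (k * s t)) *\<^sub>R \<nu> t + (sin (k * s t) * sin (k * s t)) *\<^sub>R \<nu> t"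
      unfolding A[of t, symmetric] B[of t, symmetric] by (simp add: algebra_simps)
    also have "\<dots> = \<nu> t"
      by (simp only: power2_eq_square[symmetric] scaleR_add_left[symmetric] sin_cos_squared_add2
          scaleR_one)
    finally show ?thesis ..
  qed
  \<comment> \<open>This is the centre of curvature; \<gamma>' = v T and \<nu>' / k = - v T
    cancel.\<close>
  have "((\<lambda>t. \<gamma> t + (1/k) *\<^sub>R \<nu> t) has_vector_derivative 0) (at t)" for t
    by (rule has_vector_derivative_eq_rhs[OF has_vector_derivative_add[OF d\<gamma>
          bounded_linear.has_vector_derivative[OF bounded_linear_scaleR_right d\<nu>]]])
      (use k in simp)
  then obtain c where c: "\<And>t. \<gamma> t + (1/k) *\<^sub>R \<nu> t = c"
    using has_vector_derivative_zero_constant[of UNIV "\<lambda>t. \<gamma> t + (1/k) *\<^sub>R \<nu> t"] by auto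
  have "\<gamma> t = c + sin (k * s t) *\<^sub>R ((1/k) *\<^sub>R A) + cos (k * s t) *\<^sub>R (- (1/k) *\<^sub>R B)" for t
    using c[of t] unfolding \<nu>_eq by (auto simp: algebra_simps)
  then show ?thesis by (rule that)
qed

section \<open>Periodicity against openness\<close>

lemma periodic_image_atMost_0:
  fixes f :: "real \<Rightarrow> 'a"
  assumes per: "\<And>x (n::int). f (x + n * P) = f x" and P: "P > 0"
  shows "f ` {..0} = f ` {0<..P}"
proof (intro equalityI image_subsetI)
  fix x :: real assume "x \<in> {..0}"
  \<comment> \<open>The least number of periods that moves x strictly above 0. Minimality keeps the
    shifted point at or below P, so it lies in the half-open period, which is disjoint from the
    ray.\<close>
  define n where "n = \<lfloor>- x / P\<rfloor> + 1"
  have "of_int n - 1 \<le> - x / P" "- x / P < of_int n"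
    unfolding n_def by linarith+
  then have "x + n * P \<in> {0<..P}"
    using P by (auto simp: field_simps)
  then show "f x \<in> f ` {0<..P}"
    using per[of x n] by (metis image_eqI)
next
  fix x assume "x \<in> {0<..P}"
  then have "x + (- 1 :: int) * P \<in> {..0}" by simp
  then show "f x \<in> f ` {..0}"
    using per[of x "-1"] by (metis image_eqI)
qed

lemma open_curve_not_constant_curvature:
  assumes op: "open_curve \<gamma>" and compl: "complete_curve \<gamma>" and \<nu>: "unit_normal \<gamma> \<nu>"
    and curv: "\<And>t. curvature \<gamma> \<nu> t = k" and k: "k \<noteq> 0"
  shows False
proof -
  have reg: "regular_immersion \<gamma>"
    using op by (simp add: open_curve_def)
  obtain s where s: "\<And>t. (s has_real_derivative norm (vderiv \<gamma> t)) (at t)" "s 0 = 0"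
      "strict_mono s" "surj s"
    using arc_length_parameter[OF reg compl] by blast
  obtain c A B where \<gamma>: "\<And>t. \<gamma> t = c + sin (k * s t) *\<^sub>R A + cos (k * s t) *\<^sub>R B"
    using constant_curvature_circle[OF reg \<nu> curv k s(1)] by blast
  define f where "f x = c + sin (k * x) *\<^sub>R A + cos (k * x) *\<^sub>R B" for x
  define P where "P = 2 * pi / \<bar>k\<bar>"
  have P: "P > 0"
    using k by (simp add: P_def)
  have per: "f (x + n * P) = f x" for x and n :: int
  proof -
    \<comment> \<open>P is defined with |k|, so k P is 2 pi up to the sign of k; \<open>m\<close>
      absorbs that sign.\<close>
    define m where "m = (if k > 0 then n else - n)"
    have "k * (x + n * P) = k * x + 2 * pi * m"
      using k by (auto simp: P_def m_def field_simps abs_if)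
    then show ?thesis
      by (simp add: f_def sin_add cos_add)
  qed
  obtain b where b: "s b = P"
    using s(4) by (metis surjD)
  then have "b > 0"
    using s(2,3) P by (metis strict_mono_less)
  \<comment> \<open>Monotonicity with s(0) = 0 and s(b) = P matches parameter intervals with arc
    length intervals; surjectivity turns these preimages into images.\<close>
  have "{..0} = s -` {..0}" "{0<..b} = s -` {0<..P}"
    using strict_mono_less_eq[OF s(3), of _ 0] strict_mono_less[OF s(3), of 0]
      strict_mono_less_eq[OF s(3), of _ b] s(2) b by auto
  then have "s ` {..0} = {..0}" "s ` {0<..b} = {0<..P}"
    using surj_image_vimage_eq[OF s(4)] by metis+
  moreover have "\<gamma> = f \<circ> s"
    using \<gamma> by (auto simp: f_def)
  ultimately have "\<gamma> ` {..0} = \<gamma> ` {0<..b}"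
    using periodic_image_atMost_0[OF per P] by (metis image_comp)
  moreover have "arc_length \<gamma> {0<..b} < \<infinity>"
  proof -
    \<comment> \<open>Adding the endpoint 0 gives a compact interval, whose length is the increment
      of \<open>s\<close>.\<close>
    have "arc_length \<gamma> {0<..b} \<le> arc_length \<gamma> {0..b}"
      unfolding arc_length_def by (intro nn_integral_mono) (auto split: split_indicator)
    also have "\<dots> < \<infinity>"
      using arc_length_Icc[OF reg s(1), of 0 b] \<open>b > 0\<close> by simp
    finally show ?thesis .
  qed
  moreover have "arc_length \<gamma> {..0} = \<infinity>"
    using compl by (simp add: complete_curve_def)
  moreover have "is_interval {..0::real}" "is_interval {0<..b}" "{..0} \<inter> {0<..b} = {}"
    by (auto simp: is_interval_1)
  ultimately show False
    using op unfolding open_curve_def by blast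
qed

theorem proposition11:
  fixes \<gamma> \<nu> :: "real \<Rightarrow> real^2" and V :: "real^2"
  assumes "open_curve \<gamma>"
    and "complete_curve \<gamma>"
    and "unit_normal \<gamma> \<nu>"
    and "translator \<gamma> \<nu> V"
    and "\<And>p q :: nat \<Rightarrow> real.
      filterlim p at_bot sequentially \<Longrightarrow> filterlim q at_top sequentially \<Longrightarrow>
      (\<lambda>i. (curvature \<gamma> \<nu> (p i) * arc_deriv \<gamma> (curvature \<gamma> \<nu>) (p i) + V \<bullet> arc_deriv \<gamma> \<gamma> (p i))
         - (curvature \<gamma> \<nu> (q i) * arc_deriv \<gamma> (curvature \<gamma> \<nu>) (q i) + V \<bullet> arc_deriv \<gamma> \<gamma> (q i)))
        \<longlonglongrightarrow> 0"
  shows "straight_line (range \<gamma>)"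
proof -
  have reg: "regular_immersion \<gamma>"
    using assms(1) by (simp add: open_curve_def)
  obtain k where k: "\<And>t. curvature \<gamma> \<nu> t = k"
    using constant_curvature[OF reg assms(3-5)] by blast
  have "k = 0"
    using open_curve_not_constant_curvature[OF assms(1-3) k] by blast
  obtain s where s: "\<And>t. (s has_real_derivative norm (vderiv \<gamma> t)) (at t)" "s 0 = 0"
      "strict_mono s" "surj s"
    using arc_length_parameter[OF reg assms(2)] by blast
  show ?thesis
    using constant_curvature_zero_line[OF reg assms(3) _ s(1,4)] k \<open>k = 0\<close> by simp
qed

end
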